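(* For every abelian group $G$ and every endomorphism $f\colon G\to G$, $$\widetilde{\mathrm{ent}}^*(f)=\widetilde h\big((\mathcal S^{\wedge}(G),d^*_{[\,:]}),\mathcal S^{\wedge}(f)\big).$$ That is, on the category of flows of abelian groups, the intrinsic adjoint algebraic entropy $\widetilde{\mathrm{ent}}^*$ coincides with the intrinsic functorial entropy $\widetilde h\circ\overline{\mathcal S}^{\wedge}$, where $\overline{\mathcal S}^{\wedge}(G,f)=(\mathcal S^{\wedge}(G),\mathcal S^{\wedge}(f))$.
   Context: A generalized quasimetric on a non-empty set $S$ is a function $d\colon S\times S\to\mathbb R_{\ge0}\cup\{\infty\}$ with (QM1) $d(x,y)=d(y,x)=0$ if and only if $x=y$, and (QM2) $d(x,z)\le d(x,y)+d(y,z)$ for all $x,y,z$. It induces the partial order $x\le y\iff d(y,x)=0$. The category $\mathcal L_{qm}$ has as objects the pairs $(S,d)$ such that $d$ is a generalized quasimetric, $(S,\le)$ is a join-semilattice (join written $+$) with bottom element $0$, and (QM3) $d(x,y)=d(x,x+y)$ for all $x,y$; its morphisms are the maps $\phi\colon (S,d)\to(S',d')$ with $\phi(x+y)=\phi(x)+\phi(y)$, $\phi(0)=0$ and $d'(\phi(x),\phi(y))\le d(x,y)$ for all $x,y$. A flow of a category is a pair consisting of an object and an endomorphism of it. For a flow $((S,d),\phi)$ of $\mathcal L_{qm}$, $x\in S$ is $\phi$-inert if $d(x,\phi(x))<\infty$; $\mathcal I_\phi(S)$ is the set of $\phi$-inert elements; $T_n(\phi,x)=x+\phi(x)+\dots+\phi^{n-1}(x)$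 for $n\ge1$. For $x\in\mathcal I_\phi(S)$ put $\widetilde h(\phi,x)=\lim_{n\to\infty}\frac{d(x,T_n(\phi,x))}{n}$ (this limit exists), and $\widetilde h(S,\phi)=\widetilde h(\phi)=\sup\{\widetilde h(\phi,x)\mid x\in\mathcal I_\phi(S)\}\in\mathbb R_{\ge0}\cup\{\infty\}$. For an abelian group $G$, $\mathcal S^{\wedge}(G)$ is the set of all subgroups of $G$ ordered by inverse inclusion, so that the join is $H\cap H'$ and the bottom element is $G$, with generalized quasimetric $d^*_{[\,:]}(H,H')=\log[H:H\cap H']$ (equal to $\infty$ if the index is infinite); it is an object of $\mathcal L_{qm}$. For a homomorphism $f\colon G\to G'$ of abelian groups, $\mathcal S^{\wedge}(f)\colon\mathcal S^\wedge(G')\to\mathcal S^\wedge(G)$ is $H\mapsto f^{-1}(H)$; this gives a (contravariant) functor from abelian groups to $\mathcal L_{qm}$, and $\overline{\mathcal S}^{\wedge}$ is the induced functor on flows. Intrinsic adjoint algebraic entropy: for an endomorphism $f$ of an abelian group $G$, a subgroup $H$ of $G$ is $f$-inert if $(H+f(H))/H$ is finite; $\mathcal I_f(G)$ is the family of $f$-inert subgroups. For $H\in\mathcal I_f(G)$, $$\widetilde{\mathrm{ent}}^*(f,H)=\lim_{n\to\infty}\frac1n\log\left|\frac{H}{H\cap f^{-1}(H)\cap\dots\cap f^{-n+1}(H)}\right|,$$ where $f^{-k}(H)=(f^k)^{-1}(H)$, and $\widetilde{\mathrm{ent}}^*(f)=\sup\{\widetilde{\mathrm{ent}}^*(f,H)\mid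 H\in\mathcal I_f(G)\}$. *)

theory Defs
  imports "HOL-Algebra.Algebra" "HOL-Analysis.Analysis"
begin

section \<open>The category of generalized quasimetric semilattices\<close>

text \<open>
  An object is a pair of a carrier and a function \<open>d\<close>; the order, the join and the bottom
  element are not data but are determined by \<open>d\<close>.  Values in \<open>[0, \<infinity>]\<close> are rendered by \<^typ>\<open>ennreal\<close>.
\<close>

record 'a qm_space = "'a partial_object" +
  qdist :: "'a \<Rightarrow> 'a \<Rightarrow> ennreal"

definition qm_order :: "'a qm_space \<Rightarrow> 'a gorder" where
  "qm_order S = \<lparr>carrier = carrier S, eq = (=), le = (\<lambda>x y. qdist S y x = 0)\<rparr>"

abbreviation qm_join :: "'a qm_space \<Rightarrow> 'a \<Rightarrow> 'a \<Rightarrow> 'a" where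
  "qm_join S \<equiv> join (qm_order S)"

abbreviation qm_bottom :: "'a qm_space \<Rightarrow> 'a" where
  "qm_bottom S \<equiv> bottom (qm_order S)"

locale generalized_quasimetric =
  fixes S :: "'a qm_space"
  assumes nonempty: "carrier S \<noteq> {}"
    and QM1: "\<lbrakk>x \<in> carrier S; y \<in> carrier S\<rbrakk>
           \<Longrightarrow> (qdist S x y = 0 \<and> qdist S y x = 0) \<longleftrightarrow> x = y"
    and QM2: "\<lbrakk>x \<in> carrier S; y \<in> carrier S; z \<in> carrier S\<rbrakk>
           \<Longrightarrow> qdist S x z \<le> qdist S x y + qdist S y z"

locale Lqm_object = generalized_quasimetric +
  assumes join_semilattice: "upper_semilattice (qm_order S)"
    and has_bottom: "weak_partial_order_bottom (qm_order S)"
    and QM3: "\<lbrakk>x \<in> carrier S; y \<in> carrier S\<rbrakk>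
           \<Longrightarrow> qdist S x y = qdist S x (qm_join S x y)"

definition Lqm_hom :: "'a qm_space \<Rightarrow> 'b qm_space \<Rightarrow> ('a \<Rightarrow> 'b) set" where
  "Lqm_hom S S' = {\<phi>. \<phi> \<in> carrier S \<rightarrow> carrier S' \<and>
     (\<forall>x\<in>carrier S. \<forall>y\<in>carrier S. \<phi> (qm_join S x y) = qm_join S' (\<phi> x) (\<phi> y)) \<and>
     \<phi> (qm_bottom S) = qm_bottom S' \<and>
     (\<forall>x\<in>carrier S. \<forall>y\<in>carrier S. qdist S' (\<phi> x) (\<phi> y) \<le> qdist S x y)}"

definition Lqm_flow :: "'a qm_space \<Rightarrow> ('a \<Rightarrow> 'a) \<Rightarrow> bool" where
  "Lqm_flow S \<phi> \<longleftrightarrow> Lqm_object S \<and> \<phi> \<in> Lqm_hom S S"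


section \<open>Intrinsic semilattice entropy of a flow\<close>

definition inert_elements :: "'a qm_space \<Rightarrow> ('a \<Rightarrow> 'a) \<Rightarrow> 'a set" where
  "inert_elements S \<phi> = {x \<in> carrier S. qdist S x (\<phi> x) < \<infinity>}"

text \<open>
  \<open>qm_trajectory S \<phi> x n\<close> is the join of \<open>x, \<phi> x, \<dots>, (\<phi> ^^ (n - 1)) x\<close>; for \<open>n = 0\<close> it is the
  empty join.
\<close>

primrec qm_trajectory :: "'a qm_space \<Rightarrow> ('a \<Rightarrow> 'a) \<Rightarrow> 'a \<Rightarrow> nat \<Rightarrow> 'a" where
  "qm_trajectory S \<phi> x 0 = qm_bottom S"
| "qm_trajectory S \<phi> x (Suc n) = qm_join S (qm_trajectory S \<phi> x n) ((\<phi> ^^ n) x)"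

definition intrinsic_entropy_at :: "'a qm_space \<Rightarrow> ('a \<Rightarrow> 'a) \<Rightarrow> 'a \<Rightarrow> ennreal" where
  "intrinsic_entropy_at S \<phi> x = lim (\<lambda>n. qdist S x (qm_trajectory S \<phi> x n) / of_nat n)"

definition intrinsic_entropy :: "'a qm_space \<Rightarrow> ('a \<Rightarrow> 'a) \<Rightarrow> ennreal" where
  "intrinsic_entropy S \<phi> = (SUP x\<in>inert_elements S \<phi>. intrinsic_entropy_at S \<phi> x)"


section \<open>The contravariant subgroup functor\<close>

text \<open>Abelian groups are written multiplicatively, as in HOL-Algebra: \<open>H + K\<close> is \<open>H <#>\<^bsub>G\<^esub> K\<close>.\<close>

definition quotient_group :: "('a, 'b) monoid_scheme \<Rightarrow> 'a set \<Rightarrow> 'a set \<Rightarrow> 'a set monoid" where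
  "quotient_group G H K = (G\<lparr>carrier := H\<rparr>) Mod K"

definition log_size :: "'a set \<Rightarrow> ennreal" where
  "log_size A = (if finite A then ennreal (ln (real (card A))) else \<infinity>)"

definition subgroup_qdist :: "('a, 'b) monoid_scheme \<Rightarrow> 'a set \<Rightarrow> 'a set \<Rightarrow> ennreal" where
  "subgroup_qdist G H H' = log_size (rcosets\<^bsub>G\<lparr>carrier := H\<rparr>\<^esub> (H \<inter> H'))"

definition subgroup_qm_space :: "('a, 'b) monoid_scheme \<Rightarrow> 'a set qm_space" where
  "subgroup_qm_space G = \<lparr>carrier = {H. subgroup H G}, qdist = subgroup_qdist G\<rparr>"

definition subgroup_preimage :: "('a, 'b) monoid_scheme \<Rightarrow> ('a \<Rightarrow> 'c) \<Rightarrow> 'c set \<Rightarrow> 'a set" where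
  "subgroup_preimage G f H = {x \<in> carrier G. f x \<in> H}"


section \<open>Intrinsic adjoint algebraic entropy\<close>

definition inert_subgroups :: "('a, 'b) monoid_scheme \<Rightarrow> ('a \<Rightarrow> 'a) \<Rightarrow> 'a set set" where
  "inert_subgroups G f =
     {H. subgroup H G \<and> finite (carrier (quotient_group G (H <#>\<^bsub>G\<^esub> (f ` H)) H))}"

definition cotrajectory :: "('a, 'b) monoid_scheme \<Rightarrow> ('a \<Rightarrow> 'a) \<Rightarrow> 'a set \<Rightarrow> nat \<Rightarrow> 'a set" where
  "cotrajectory G f H n = H \<inter> (\<Inter>k\<in>{1..<n}. subgroup_preimage G (f ^^ k) H)"

definition intrinsic_adjoint_entropy_at ::
    "('a, 'b) monoid_scheme \<Rightarrow> ('a \<Rightarrow> 'a) \<Rightarrow> 'a set \<Rightarrow> ennreal" where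
  "intrinsic_adjoint_entropy_at G f H =
     lim (\<lambda>n. log_size (carrier (quotient_group G H (cotrajectory G f H n))) / of_nat n)"

definition intrinsic_adjoint_entropy :: "('a, 'b) monoid_scheme \<Rightarrow> ('a \<Rightarrow> 'a) \<Rightarrow> ennreal" where
  "intrinsic_adjoint_entropy G f =
     (SUP H\<in>inert_subgroups G f. intrinsic_adjoint_entropy_at G f H)"


section \<open>The subgroup functor takes values in the category\<close>

lemma rcosets_restrict: "rcosets\<^bsub>G\<lparr>carrier := H\<rparr>\<^esub> K = (\<lambda>a. K #>\<^bsub>G\<^esub> a) ` H"
  by (auto simp: RCOSETS_def r_coset_def)

lemma (in group) r_coset_eqD:
  assumes "subgroup K G" "a \<in> carrier G" "b \<in> carrier G" "K #> a = K #> b"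
  shows "a \<otimes> inv b \<in> K"
proof -
  have "a \<in> K #> b" using assms rcos_self by blast
  then obtain k where k: "k \<in> K" "a = k \<otimes> b" by (auto simp: r_coset_def)
  have "k \<in> carrier G" by (rule subgroup.mem_carrier[OF assms(1) k(1)])
  then have "k \<otimes> b \<otimes> inv b = k" using assms(3) by (simp add: m_assoc)
  then show ?thesis unfolding k(2) using k(1) by (simp only:)
qed

lemma (in group) r_coset_eqI:
  assumes "subgroup K G" "a \<in> carrier G" "b \<in> carrier G" "a \<otimes> inv b \<in> K"
  shows "K #> a = K #> b"
proof -
  have "a = (a \<otimes> inv b) \<otimes> b" using assms by (simp add: m_assoc)
  then have "a \<in> K #> b" using assms(4) unfolding r_coset_def by blast
  then show ?thesis using assms repr_independence by metis
qed

lemma (in group) rcosets_bound: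
  assumes K: "subgroup K G" and H: "H \<subseteq> carrier G"
    and g: "\<forall>a\<in>H. \<forall>b\<in>H. g a = g b \<longrightarrow> a \<otimes> inv b \<in> K"
    and Y: "finite Y" "g ` H \<subseteq> Y"
  shows "finite (rcosets\<^bsub>G\<lparr>carrier := H\<rparr>\<^esub> K)"
    and "card (rcosets\<^bsub>G\<lparr>carrier := H\<rparr>\<^esub> K) \<le> card Y"
proof -
  have fin: "finite (g ` H)" using Y finite_subset by blast
  have *: "K #> a = K #> inv_into H g (g a)" if "a \<in> H" for a
  proof -
    have b: "inv_into H g (g a) \<in> H" using that by (blast intro: inv_into_into)
    have "g a = g (inv_into H g (g a))" using that by (simp add: f_inv_into_f)
    with g that b have "a \<otimes> inv (inv_into H g (g a)) \<in> K" by blast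
    then show ?thesis using that b H K r_coset_eqI by blast
  qed
  have "rcosets\<^bsub>G\<lparr>carrier := H\<rparr>\<^esub> K = (\<lambda>y. K #> inv_into H g y) ` (g ` H)"
    unfolding rcosets_restrict image_image by (rule image_cong) (use * in blast)+
  with fin have "finite (rcosets\<^bsub>G\<lparr>carrier := H\<rparr>\<^esub> K)
      \<and> card (rcosets\<^bsub>G\<lparr>carrier := H\<rparr>\<^esub> K) \<le> card (g ` H)"
    by (metis card_image_le finite_imageI)
  moreover have "card (g ` H) \<le> card Y" using Y card_mono by blast
  ultimately show "finite (rcosets\<^bsub>G\<lparr>carrier := H\<rparr>\<^esub> K)"
    and "card (rcosets\<^bsub>G\<lparr>carrier := H\<rparr>\<^esub> K) \<le> card Y" by auto
qed

lemma log_size_mono: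
  assumes "finite A" "card A \<le> card B" "A \<noteq> {}" "finite B"
  shows "log_size A \<le> log_size B"
proof -
  have "0 < card A" using assms card_gt_0_iff by blast
  then have "ln (real (card A)) \<le> ln (real (card B))" using assms by simp
  then show ?thesis using assms by (simp add: log_size_def ennreal_leI)
qed

lemma (in group) subgroup_qdist_eq_0_iff:
  assumes H: "subgroup H G" and H': "subgroup H' G"
  shows "subgroup_qdist G H H' = 0 \<longleftrightarrow> H \<subseteq> H'"
proof -
  let ?K = "H \<inter> H'" and ?Q = "rcosets\<^bsub>G\<lparr>carrier := H\<rparr>\<^esub> (H \<inter> H')"
  have K: "subgroup ?K G" using H H' subgroups_Inter_pair by blast
  have HG: "H \<subseteq> carrier G" using H subgroup.subset by blast
  have one: "\<one> \<in> H" using H subgroup.one_closed by blast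
  have ne: "?Q \<noteq> {}" unfolding rcosets_restrict using one by blast
  show ?thesis
  proof
    assume "subgroup_qdist G H H' = 0"
    then have fin: "finite ?Q" and ln0: "ln (real (card ?Q)) \<le> 0"
      by (auto simp: subgroup_qdist_def log_size_def ennreal_eq_0_iff split: if_splits)
    have "0 < card ?Q" using fin ne card_gt_0_iff by blast
    then have "card ?Q = 1" using ln0 by simp
    then obtain q where q: "?Q = {q}" using card_1_singletonE by blast
    show "H \<subseteq> H'"
    proof
      fix a assume a: "a \<in> H"
      have "?K #> a = ?K #> \<one>" using q a one unfolding rcosets_restrict by blast
      then have "a \<otimes> inv \<one> \<in> ?K" using r_coset_eqD[OF K _ one_closed] a HG by blast
      then show "a \<in> H'" using a HG by (simp add: subset_eq)
    qed
  next
    assume "H \<subseteq> H'"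
    then have eq: "?K = H" by blast
    have "?Q \<subseteq> {H}" unfolding rcosets_restrict eq
      using coset_join2[OF _ H] HG by auto
    then have "?Q = {H}" using ne by blast
    then show "subgroup_qdist G H H' = 0" by (simp add: subgroup_qdist_def log_size_def)
  qed
qed

lemma (in group) subgroup_qdist_triangle:
  assumes A: "subgroup A G" and B: "subgroup B G" and C: "subgroup C G"
  shows "subgroup_qdist G A C \<le> subgroup_qdist G A B + subgroup_qdist G B C"
proof -
  let ?Q = "\<lambda>H K. rcosets\<^bsub>G\<lparr>carrier := H\<rparr>\<^esub> (H \<inter> K)"
  show ?thesis
  proof (cases "finite (?Q A B) \<and> finite (?Q B C)")
    case False
    then show ?thesis by (auto simp: subgroup_qdist_def log_size_def)
  next
    case True
    have sub: "subgroup (A \<inter> B) G" "subgroup (A \<inter> C) G" "subgroup (B \<inter> C) G"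
      using A B C subgroups_Inter_pair by auto
    have AG: "A \<subseteq> carrier G" and BG: "B \<subseteq> carrier G" using A B subgroup.subset by auto
    define r where "r a = (SOME s. s \<in> A \<and> (A \<inter> B) #> s = (A \<inter> B) #> a)" for a
    have r: "r a \<in> A \<and> (A \<inter> B) #> r a = (A \<inter> B) #> a" if "a \<in> A" for a
      unfolding r_def by (rule someI[of _ a]) (use that in simp)
    have rB: "a \<otimes> inv (r a) \<in> B" if "a \<in> A" for a
    proof -
      have "a \<in> carrier G" "r a \<in> carrier G" using r[OF that] that AG by blast+
      then have "a \<otimes> inv (r a) \<in> A \<inter> B" using r_coset_eqD[OF sub(1)] r[OF that] by metis
      then show ?thesis by blast
    qed
    have rcong: "r a = r b" if "(A \<inter> B) #> a = (A \<inter> B) #> b" for a b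
      unfolding r_def by (simp only: that)
    define g where "g a = ((A \<inter> B) #> a, (B \<inter> C) #> (a \<otimes> inv (r a)))" for a
    have gim: "g ` A \<subseteq> ?Q A B \<times> ?Q B C"
      unfolding rcosets_restrict
    proof (rule image_subsetI)
      fix a assume "a \<in> A"
      then show "g a \<in> (\<lambda>a. (A \<inter> B) #> a) ` A \<times> (\<lambda>a. (B \<inter> C) #> a) ` B"
        unfolding g_def using rB[of a] by (intro SigmaI imageI)
    qed
    have ginj: "a \<otimes> inv b \<in> A \<inter> C" if a: "a \<in> A" and b: "b \<in> A" and e: "g a = g b" for a b
    proof -
      let ?s = "r b"
      have rr: "r a = ?s" using e rcong unfolding g_def by blast
      have c: "a \<in> carrier G" "b \<in> carrier G" "?s \<in> carrier G" using a b r[OF b] AG by blast+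
      have "(B \<inter> C) #> (a \<otimes> inv ?s) = (B \<inter> C) #> (b \<otimes> inv ?s)"
        using e unfolding g_def rr by blast
      then have "(a \<otimes> inv ?s) \<otimes> inv (b \<otimes> inv ?s) \<in> B \<inter> C"
        using r_coset_eqD[OF sub(3)] c by (meson inv_closed m_closed)
      moreover have "(a \<otimes> inv ?s) \<otimes> inv (b \<otimes> inv ?s) = a \<otimes> inv b"
      proof -
        have "inv ?s \<otimes> (?s \<otimes> inv b) = inv b"
          using c by (simp flip: m_assoc)
        then show ?thesis using c by (simp add: inv_mult_group m_assoc)
      qed
      ultimately have "a \<otimes> inv b \<in> C" by simp
      moreover have "a \<otimes> inv b \<in> A"
        using a b A by (simp add: subgroup.m_closed subgroup.m_inv_closed)
      ultimately show ?thesis by blast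
    qed
    have fin: "finite (?Q A B \<times> ?Q B C)" using True by blast
    have ginj': "\<forall>a\<in>A. \<forall>b\<in>A. g a = g b \<longrightarrow> a \<otimes> inv b \<in> A \<inter> C"
      using ginj by blast
    note 1 = rcosets_bound[OF sub(2) AG ginj' fin gim]
    have ne: "?Q A B \<noteq> {}" "?Q B C \<noteq> {}" "?Q A C \<noteq> {}"
      unfolding rcosets_restrict using A B subgroup.one_closed by auto
    then have pos: "0 < card (?Q A B)" "0 < card (?Q B C)" "0 < card (?Q A C)"
      using True 1 by (auto simp: card_gt_0_iff)
    have "ln (real (card (?Q A C))) \<le> ln (real (card (?Q A B) * card (?Q B C)))"
      using 1 pos by (simp add: card_cartesian_product flip: of_nat_mult)
    also have "\<dots> = ln (real (card (?Q A B))) + ln (real (card (?Q B C)))"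
      using pos by (simp add: ln_mult)
    finally show ?thesis using True 1 pos
      by (simp add: subgroup_qdist_def log_size_def flip: ennreal_plus)
  qed
qed

lemma (in group) subgroup_qm_order_simps:
  "carrier (qm_order (subgroup_qm_space G)) = {H. subgroup H G}"
  "eq (qm_order (subgroup_qm_space G)) = (=)"
  "\<lbrakk>subgroup H G; subgroup H' G\<rbrakk> \<Longrightarrow> le (qm_order (subgroup_qm_space G)) H H' \<longleftrightarrow> H' \<subseteq> H"
  by (simp_all add: qm_order_def subgroup_qm_space_def subgroup_qdist_eq_0_iff)

lemma (in group) subgroup_partial_order: "partial_order (qm_order (subgroup_qm_space G))"
  by unfold_locales (auto simp: subgroup_qm_order_simps)

lemma (in group) subgroup_least_join:
  assumes "subgroup H G" "subgroup H' G"
  shows "least (qm_order (subgroup_qm_space G)) (H \<inter> H')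
           (Upper (qm_order (subgroup_qm_space G)) {H, H'})"
proof (rule least_UpperI)
  have int: "subgroup (H \<inter> H') G" by (rule subgroups_Inter_pair[OF assms])
  let ?L = "qm_order (subgroup_qm_space G)"
  show "H \<inter> H' \<in> carrier ?L" using int by (simp add: subgroup_qm_order_simps)
  show sub: "{H, H'} \<subseteq> carrier ?L" using assms by (simp add: subgroup_qm_order_simps)
  fix K
  {
    assume "K \<in> {H, H'}"
    then have "subgroup K G" "H \<inter> H' \<subseteq> K" using assms by blast+
    then show "le ?L K (H \<inter> H')" using int by (simp only: subgroup_qm_order_simps)
  next
    assume K: "K \<in> Upper ?L {H, H'}"
    then have "subgroup K G" by (simp add: Upper_def subgroup_qm_order_simps(1))
    moreover from K sub have "le ?L H K" "le ?L H' K" by blast+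
    ultimately show "le ?L (H \<inter> H') K"
      using assms int by (simp only: subgroup_qm_order_simps) blast
  }
qed

lemma (in group) subgroup_upper_semilattice:
  "upper_semilattice (qm_order (subgroup_qm_space G))"
proof (intro upper_semilattice.intro upper_semilattice_axioms.intro)
  fix H H' assume "H \<in> carrier (qm_order (subgroup_qm_space G))"
    "H' \<in> carrier (qm_order (subgroup_qm_space G))"
  then have "subgroup H G" "subgroup H' G" by (simp_all add: subgroup_qm_order_simps)
  from subgroup_least_join[OF this]
  show "\<exists>s. least (qm_order (subgroup_qm_space G)) s
      (Upper (qm_order (subgroup_qm_space G)) {H, H'})" by (rule exI)
qed (rule subgroup_partial_order)

lemma (in group) subgroup_join:
  assumes "subgroup H G" "subgroup H' G"
  shows "qm_join (subgroup_qm_space G) H H' = H \<inter> H'"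
proof -
  interpret upper_semilattice "qm_order (subgroup_qm_space G)"
    by (rule subgroup_upper_semilattice)
  show ?thesis unfolding join_def sup_def
    by (rule some_equality[where P = "\<lambda>x. least _ x _"], rule subgroup_least_join[OF assms])
      (rule least_unique[OF _ subgroup_least_join[OF assms]])
qed

lemma (in group) subgroup_least_bottom:
  "least (qm_order (subgroup_qm_space G)) (carrier G) (carrier (qm_order (subgroup_qm_space G)))"
  using subgroup_self
  by (auto simp: least_def subgroup_qm_order_simps dest: subgroup.subset)

lemma (in group) subgroup_bottom: "qm_bottom (subgroup_qm_space G) = carrier G"
proof -
  interpret upper_semilattice "qm_order (subgroup_qm_space G)"
    by (rule subgroup_upper_semilattice)
  show ?thesis unfolding bottom_def
    by (rule some_equality[where P = "\<lambda>x. least _ x _"], rule subgroup_least_bottom)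
      (rule least_unique[OF _ subgroup_least_bottom])
qed

lemma (in group) subgroup_Lqm_object: "Lqm_object (subgroup_qm_space G)"
proof (intro Lqm_object.intro generalized_quasimetric.intro Lqm_object_axioms.intro)
  show "carrier (subgroup_qm_space G) \<noteq> {}"
    using subgroup_self by (auto simp: subgroup_qm_space_def)
next
  fix H H' assume "H \<in> carrier (subgroup_qm_space G)" "H' \<in> carrier (subgroup_qm_space G)"
  then have s: "subgroup H G" "subgroup H' G" by (auto simp: subgroup_qm_space_def)
  show "(qdist (subgroup_qm_space G) H H' = 0 \<and> qdist (subgroup_qm_space G) H' H = 0) \<longleftrightarrow> H = H'"
    using s by (auto simp: subgroup_qm_space_def subgroup_qdist_eq_0_iff)
  show "qdist (subgroup_qm_space G) H H'
      = qdist (subgroup_qm_space G) H (qm_join (subgroup_qm_space G) H H')"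
    using s by (simp add: subgroup_join) (simp add: subgroup_qm_space_def subgroup_qdist_def)
next
  fix A B C assume "A \<in> carrier (subgroup_qm_space G)" "B \<in> carrier (subgroup_qm_space G)"
    "C \<in> carrier (subgroup_qm_space G)"
  then show "qdist (subgroup_qm_space G) A C
      \<le> qdist (subgroup_qm_space G) A B + qdist (subgroup_qm_space G) B C"
    using subgroup_qdist_triangle by (simp add: subgroup_qm_space_def)
next
  show "upper_semilattice (qm_order (subgroup_qm_space G))"
    by (rule subgroup_upper_semilattice)
next
  show "weak_partial_order_bottom (qm_order (subgroup_qm_space G))"
    using subgroup_partial_order subgroup_least_bottom
    by (auto simp: weak_partial_order_bottom_def weak_partial_order_bottom_axioms_def
        partial_order_def)
qed

lemma (in group_hom) subgroup_preimage_subgroup: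
  assumes "subgroup K H"
  shows "subgroup (subgroup_preimage G h K) G"
  by (rule subgroup.intro)
    (auto simp: subgroup_preimage_def subgroup.m_closed[OF assms] subgroup.one_closed[OF assms]
      subgroup.m_inv_closed[OF assms])

lemma (in group_hom) subgroup_preimage_qdist_le:
  assumes K: "subgroup K H" and L: "subgroup L H"
  shows "subgroup_qdist G (subgroup_preimage G h K) (subgroup_preimage G h L)
      \<le> subgroup_qdist H K L"
proof (cases "finite (rcosets\<^bsub>H\<lparr>carrier := K\<rparr>\<^esub> (K \<inter> L))")
  case False
  then show ?thesis by (simp add: subgroup_qdist_def log_size_def)
next
  case True
  let ?P = "subgroup_preimage G h"
  have KL: "subgroup (K \<inter> L) H" using K L H.subgroups_Inter_pair by blast
  have eq: "?P K \<inter> ?P L = ?P (K \<inter> L)" by (auto simp: subgroup_preimage_def)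
  have sub: "subgroup (?P (K \<inter> L)) G" by (rule subgroup_preimage_subgroup[OF KL])
  have PG: "?P K \<subseteq> carrier G" by (auto simp: subgroup_preimage_def)
  define g where "g a = (K \<inter> L) #>\<^bsub>H\<^esub> h a" for a
  have gim: "g ` ?P K \<subseteq> rcosets\<^bsub>H\<lparr>carrier := K\<rparr>\<^esub> (K \<inter> L)"
    unfolding rcosets_restrict g_def by (auto simp: subgroup_preimage_def)
  have ginj: "a \<otimes> inv b \<in> ?P (K \<inter> L)" if "a \<in> ?P K" "b \<in> ?P K" "g a = g b" for a b
  proof -
    have c: "a \<in> carrier G" "b \<in> carrier G" using that PG by auto
    have "h a \<otimes>\<^bsub>H\<^esub> inv\<^bsub>H\<^esub> h b \<in> K \<inter> L"
      using H.r_coset_eqD[OF KL, of "h a" "h b"] that c by (simp add: g_def)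
    then show ?thesis using c by (simp add: subgroup_preimage_def)
  qed
  have ginj': "\<forall>a\<in>?P K. \<forall>b\<in>?P K. g a = g b \<longrightarrow> a \<otimes> inv b \<in> ?P (K \<inter> L)"
    using ginj by blast
  note b = G.rcosets_bound[OF sub PG ginj' True gim]
  have "rcosets\<^bsub>G\<lparr>carrier := ?P K\<rparr>\<^esub> (?P (K \<inter> L)) \<noteq> {}"
    unfolding rcosets_restrict
    using subgroup.one_closed[OF subgroup_preimage_subgroup[OF K]] by auto
  then show ?thesis unfolding subgroup_qdist_def eq
    using log_size_mono b True by blast
qed

lemma (in group_hom) subgroup_preimage_Lqm_hom:
  "subgroup_preimage G h \<in> Lqm_hom (subgroup_qm_space H) (subgroup_qm_space G)"
proof -
  have 1: "subgroup_preimage G h (carrier H) = carrier G"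
    by (auto simp: subgroup_preimage_def)
  have 2: "subgroup_preimage G h (qm_join (subgroup_qm_space H) K L)
      = qm_join (subgroup_qm_space G) (subgroup_preimage G h K) (subgroup_preimage G h L)"
    if "subgroup K H" "subgroup L H" for K L
    using that subgroup_preimage_subgroup
    by (simp add: G.subgroup_join H.subgroup_join) (auto simp: subgroup_preimage_def)
  show ?thesis
    using 1 2 subgroup_preimage_subgroup subgroup_preimage_qdist_le
    unfolding Lqm_hom_def G.subgroup_bottom H.subgroup_bottom
    by (auto simp: subgroup_qm_space_def)
qed

lemma subgroup_preimage_comp:
  assumes "f \<in> carrier G \<rightarrow> carrier G'"
  shows "subgroup_preimage G (g \<circ> f) K = subgroup_preimage G f (subgroup_preimage G' g K)"
  using assms by (auto simp: subgroup_preimage_def)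

lemma subgroup_Lqm_flow:
  assumes "comm_group G" "f \<in> hom G G"
  shows "Lqm_flow (subgroup_qm_space G) (subgroup_preimage G f)"
proof -
  interpret comm_group G by fact
  interpret group_hom G G f by unfold_locales (rule assms(2))
  show ?thesis unfolding Lqm_flow_def
    using subgroup_Lqm_object subgroup_preimage_Lqm_hom by blast
qed

end

theory Submission
  imports Defs
begin

text \<open>
  The two entropies agree term by term, before any limit or supremum is taken.

  \<^item> In \<open>\<S>\<^sup>\<and>(G)\<close> the join is intersection and the flow is \<open>H \<mapsto> f\<^sup>-\<^sup>1(H)\<close>, so the semilattice
    trajectory of \<open>H\<close> consists of the points whose first \<open>n\<close> iterates stay in \<open>H\<close>.  Its trace
    on \<open>H\<close> is the cotrajectory, also for \<open>n = 0\<close>, where the empty join is \<open>G\<close> and the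
    cotrajectory is \<open>H\<close> (\<open>Int_qm_trajectory\<close>).  As the distance from \<open>H\<close> to \<open>K\<close> only sees
    \<open>H \<inter> K\<close>, both entropies of \<open>H\<close> are limits of one and the same sequence.

  \<^item> The two notions of inertness compare \<open>H f(H)\<close> with \<open>H\<close> and \<open>H\<close> with \<open>H \<inter> f\<^sup>-\<^sup>1(H)\<close>.  The
    cosets of \<open>H\<close> in \<open>H f(H)\<close> are those of the elements \<open>f a\<close> with \<open>a \<in> H\<close>, and \<open>f a\<close>, \<open>f b\<close>
    lie in the same coset of \<open>H\<close> exactly when \<open>a\<close>, \<open>b\<close> lie in the same coset of
    \<open>H \<inter> f\<^sup>-\<^sup>1(H)\<close>; so the two indices are equal (\<open>bij_betw_rcosets_preimage\<close>).
\<close>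

lemma log_size_less_infinity_iff: "log_size A < \<infinity> \<longleftrightarrow> finite A"
  by (simp add: log_size_def)

lemma carrier_quotient_group:
  "carrier (quotient_group G H K) = rcosets\<^bsub>G\<lparr>carrier := H\<rparr>\<^esub> K"
  by (simp add: quotient_group_def FactGroup_def)

lemma subgroup_qdist_eq_log_size_quotient:
  "subgroup_qdist G H K = log_size (carrier (quotient_group G H (H \<inter> K)))"
  by (simp add: subgroup_qdist_def carrier_quotient_group)

lemma (in group) r_coset_eq_iff:
  assumes "subgroup K G" "a \<in> carrier G" "b \<in> carrier G"
  shows "K #> a = K #> b \<longleftrightarrow> a \<otimes> inv b \<in> K"
  using assms r_coset_eqD r_coset_eqI by blast

lemma (in group) rcosets_set_mult:
  assumes H: "subgroup H G" and A: "A \<subseteq> carrier G"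
  shows "rcosets\<^bsub>G\<lparr>carrier := H <#> A\<rparr>\<^esub> H = (\<lambda>a. H #> a) ` A"
proof -
  have HG: "H \<subseteq> carrier G" using H subgroup.subset by blast
  have absorb: "H #> (h \<otimes> a) = H #> a" if "h \<in> H" "a \<in> A" for h a
  proof -
    have "h \<in> carrier G" "a \<in> carrier G" using that HG A by auto
    then show ?thesis
      using that H HG by (simp add: coset_mult_assoc[symmetric] coset_join2)
  qed
  have "\<one> \<otimes> a = a" if "a \<in> A" for a using that A by auto
  then have "A \<subseteq> H <#> A"
    unfolding set_mult_def using subgroup.one_closed[OF H] by force
  then show ?thesis
    unfolding rcosets_restrict using absorb by (auto simp: set_mult_def)
qed

text \<open>
  For abelian \<open>G\<close> this is the second isomorphism theorem \<open>H f(H) / H \<cong> f(H) / (H \<inter> f(H))\<close>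
  followed by the first one for \<open>H \<rightarrow> f(H) / (H \<inter> f(H))\<close>, whose kernel is
  \<open>H \<inter> f\<^sup>-\<^sup>1(H)\<close>.  The same map, \<open>a \<mapsto> H f(a)\<close>, is a bijection of coset spaces for every
  group, which is all that a comparison of indices requires.
\<close>

lemma (in group) bij_betw_rcosets_preimage:
  assumes f: "f \<in> hom G G" and H: "subgroup H G"
  shows "\<exists>\<theta>. bij_betw \<theta>
    (rcosets\<^bsub>G\<lparr>carrier := H\<rparr>\<^esub> (H \<inter> subgroup_preimage G f H))
    (rcosets\<^bsub>G\<lparr>carrier := H <#> f ` H\<rparr>\<^esub> H)"
proof -
  interpret f: group_hom G G f by unfold_locales (rule f)
  let ?K = "H \<inter> subgroup_preimage G f H"
  have HG: "H \<subseteq> carrier G" using H subgroup.subset by blast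
  have K: "subgroup ?K G"
    using H f.subgroup_preimage_subgroup[OF H] subgroups_Inter_pair by blast
  have same: "?K #> a = ?K #> b \<longleftrightarrow> H #> f a = H #> f b" if ab: "a \<in> H" "b \<in> H" for a b
  proof -
    have c: "a \<in> carrier G" "b \<in> carrier G" using ab HG by auto
    have "a \<otimes> inv b \<in> H" using ab H by (simp add: subgroup.m_closed subgroup.m_inv_closed)
    then show ?thesis
      unfolding r_coset_eq_iff[OF K c] r_coset_eq_iff[OF H f.hom_closed f.hom_closed, OF c]
      using c by (simp add: subgroup_preimage_def)
  qed
  define \<theta> where "\<theta> C = H #> f (SOME a. a \<in> H \<and> ?K #> a = C)" for C
  have \<theta>: "\<theta> (?K #> a) = H #> f a" if "a \<in> H" for a
  proof -
    let ?b = "SOME b. b \<in> H \<and> ?K #> b = ?K #> a"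
    have "?b \<in> H \<and> ?K #> ?b = ?K #> a" by (rule someI[of _ a]) (use that in simp)
    then show ?thesis unfolding \<theta>_def using same that by blast
  qed
  have "f ` H \<subseteq> carrier G" using HG by auto
  then have target: "rcosets\<^bsub>G\<lparr>carrier := H <#> f ` H\<rparr>\<^esub> H = (\<lambda>a. H #> f a) ` H"
    by (simp add: rcosets_set_mult[OF H] image_image)
  have "inj_on \<theta> ((\<lambda>a. ?K #> a) ` H)"
  proof (rule inj_onI)
    fix C D assume "C \<in> (\<lambda>a. ?K #> a) ` H" "D \<in> (\<lambda>a. ?K #> a) ` H" and eq: "\<theta> C = \<theta> D"
    then obtain a b where ab: "a \<in> H" "b \<in> H" and CD: "C = ?K #> a" "D = ?K #> b" by blast
    have "H #> f a = H #> f b" using eq ab unfolding CD by (simp only: \<theta>)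
    then show "C = D" unfolding CD using same[OF ab] by blast
  qed
  moreover have "\<theta> ` (\<lambda>a. ?K #> a) ` H = (\<lambda>a. H #> f a) ` H"
    unfolding image_image by (rule image_cong[OF refl \<theta>])
  ultimately show ?thesis
    unfolding target unfolding rcosets_restrict bij_betw_def by (intro exI conjI)
qed

lemma (in group) inert_subgroups_eq_inert_elements:
  assumes f: "f \<in> hom G G"
  shows "inert_subgroups G f = inert_elements (subgroup_qm_space G) (subgroup_preimage G f)"
proof -
  have "finite (carrier (quotient_group G (H <#> f ` H) H))
      \<longleftrightarrow> subgroup_qdist G H (subgroup_preimage G f H) < \<infinity>" if "subgroup H G" for H
    unfolding carrier_quotient_group subgroup_qdist_def log_size_less_infinity_iff
    using bij_betw_rcosets_preimage[OF f that] bij_betw_finite by blast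
  then show ?thesis
    by (auto simp: inert_subgroups_def inert_elements_def subgroup_qm_space_def)
qed

lemma funpow_subgroup_preimage:
  assumes f: "f \<in> carrier G \<rightarrow> carrier G" and H: "H \<subseteq> carrier G"
  shows "(subgroup_preimage G f ^^ k) H = subgroup_preimage G (f ^^ k) H"
proof (induction k)
  case 0
  show ?case using H by (auto simp: subgroup_preimage_def)
next
  case (Suc k)
  have "f ^^ Suc k = f ^^ k \<circ> f" by (rule funpow_Suc_right)
  then have "subgroup_preimage G (f ^^ Suc k) H
      = subgroup_preimage G f (subgroup_preimage G (f ^^ k) H)"
    by (simp only: subgroup_preimage_comp[OF f])
  also have "\<dots> = (subgroup_preimage G f ^^ Suc k) H"
    using Suc by simp
  finally show ?case by (rule sym)
qed

lemma (in group) qm_trajectory_subgroup_preimage: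
  assumes f: "f \<in> hom G G" and H: "subgroup H G"
  shows "qm_trajectory (subgroup_qm_space G) (subgroup_preimage G f) H n
    = {x \<in> carrier G. \<forall>k<n. (f ^^ k) x \<in> H}" (is "?T n = ?C n")
proof -
  interpret f: group_hom G G f by unfold_locales (rule f)
  have pow: "subgroup ((subgroup_preimage G f ^^ k) H) G" for k
    using H f.subgroup_preimage_subgroup by (induction k) auto
  have pre: "(subgroup_preimage G f ^^ k) H = subgroup_preimage G (f ^^ k) H" for k
    by (rule funpow_subgroup_preimage) (use subgroup.subset[OF H] in auto)
  \<comment> \<open>The join is only known to be the intersection on subgroups, so this is carried along.\<close>
  have "subgroup (?T n) G \<and> ?T n = ?C n"
  proof (induction n)
    case 0
    show ?case by (simp add: subgroup_bottom subgroup_self)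
  next
    case (Suc n)
    then have T: "?T (Suc n) = ?T n \<inter> (subgroup_preimage G f ^^ n) H"
      unfolding qm_trajectory.simps by (elim conjE) (rule subgroup_join[OF _ pow])
    have "subgroup (?T (Suc n)) G"
      unfolding T using Suc pow subgroups_Inter_pair by blast
    moreover have "?C n \<inter> subgroup_preimage G (f ^^ n) H = ?C (Suc n)"
      by (auto simp: subgroup_preimage_def less_Suc_eq)
    ultimately show ?case using Suc pre T by simp
  qed
  then show ?thesis by blast
qed

lemma (in group) Int_qm_trajectory:
  assumes f: "f \<in> hom G G" and H: "subgroup H G"
  shows "H \<inter> qm_trajectory (subgroup_qm_space G) (subgroup_preimage G f) H n
    = cotrajectory G f H n"
proof -
  have HG: "H \<subseteq> carrier G" using H subgroup.subset by blast
  \<comment> \<open>The cotrajectory omits \<open>k = 0\<close>, which on \<open>H\<close> is no condition.\<close>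
  have "(\<forall>k<n. (f ^^ k) x \<in> H) \<longleftrightarrow> (\<forall>k\<in>{1..<n}. (f ^^ k) x \<in> H)" if "x \<in> H" for x
  proof -
    have "(f ^^ k) x \<in> H" if "k = 0" for k using that \<open>x \<in> H\<close> by simp
    then show ?thesis by (metis atLeastLessThan_iff less_one not_less)
  qed
  then show ?thesis
    using HG unfolding qm_trajectory_subgroup_preimage[OF f H] cotrajectory_def
    by (auto simp: subgroup_preimage_def)
qed

lemma (in group) intrinsic_adjoint_entropy_at_eq:
  assumes "f \<in> hom G G" "subgroup H G"
  shows "intrinsic_adjoint_entropy_at G f H
    = intrinsic_entropy_at (subgroup_qm_space G) (subgroup_preimage G f) H"
proof -
  have "qdist (subgroup_qm_space G) = subgroup_qdist G" by (simp add: subgroup_qm_space_def)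
  then show ?thesis
    unfolding intrinsic_adjoint_entropy_at_def intrinsic_entropy_at_def
    by (simp only: subgroup_qdist_eq_log_size_quotient Int_qm_trajectory[OF assms])
qed

theorem theorem5p3:
  fixes G :: "('a, 'b) monoid_scheme" and f :: "'a \<Rightarrow> 'a"
  assumes "comm_group G" and "f \<in> hom G G"
  shows "intrinsic_adjoint_entropy G f =
           intrinsic_entropy (subgroup_qm_space G) (subgroup_preimage G f)"
proof -
  interpret comm_group G by fact
  show ?thesis
    unfolding intrinsic_adjoint_entropy_def intrinsic_entropy_def
  proof (rule SUP_cong)
    show "inert_subgroups G f = inert_elements (subgroup_qm_space G) (subgroup_preimage G f)"
      by (rule inert_subgroups_eq_inert_elements[OF assms(2)])
  next
    fix H assume "H \<in> inert_elements (subgroup_qm_space G) (subgroup_preimage G f)"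
    then have "subgroup H G" by (simp add: inert_elements_def subgroup_qm_space_def)
    then show "intrinsic_adjoint_entropy_at G f H
        = intrinsic_entropy_at (subgroup_qm_space G) (subgroup_preimage G f) H"
      by (rule intrinsic_adjoint_entropy_at_eq[OF assms(2)])
  qed
qed

end
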